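(* Two LPMLN programs $P$ and $Q$ are sp-strongly equivalent if and only if $\mathrm{SSE}(P)=\mathrm{SSE}(Q)$ and there exists a real number $c$ such that for every soft SE-model $(X,Y)\in\mathrm{SSE}(P)$, $W_s(P,(X,Y))=c\cdot W_s(Q,(X,Y))$.
   Context: All programs are finite and ground. A literal is an atom $a$ or its classical negation $\neg a$. An ASP rule $r$ has the form $l_1\vee\cdots\vee l_k\leftarrow l_{k+1},\dots,l_m,\ not\ l_{m+1},\dots,\ not\ l_n$ with literals $l_i$; $h(r)$, $b^+(r)$, $b^-(r)$ are the head, positive body and negative body literal sets. An interpretation is a set of literals not containing both $a$ and $\neg a$ for any atom $a$. $I\models r$ iff ($b^+(r)\subseteq I$ and $b^-(r)\cap I=\emptyset$) implies $h(r)\cap I\neq\emptyset$. For an ASP program $\Pi$ the GL-reduct is $\Pi^I=\{h(r)\leftarrow b^+(r) : r\in\Pi,\ b^-(r)\cap I=\emptyset\}$, and $I$ is a stable model of $\Pi$ iff $I\models\Pi^I$ and no proper subset of $I$ satisfies $\Pi^I$. An LPMLN program $P$ is a finite set of weighted rules $w:r$, $r$ an ASP rule, $w$ a real number (soft rule) or the symbol $\alpha$ (hard rule); $\overline{P}=\{r: w:r\in P\}$; $P^s$, $P^h$ are the sets of soft and hard rules. $P_I=\{w:r\in P : I\models r\}$; $I$ is a stable model of $P$ iff it is a stable model of $\overline{P_I}$; $\mathrm{SM}(P)$ is the set of stable models. A soft stable model of $P$ is an $X\in\mathrm{SM}(P)$ with $X\models P^h$; $\mathrm{SSM}(P)$ is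 their set. For $X\in\mathrm{SSM}(P)$, $W_s(P,X)=\exp(\sum_{w:r\in P^s,\ X\models r}w)$ and $Pr_s(P,X)=W_s(P,X)/\sum_{X'\in\mathrm{SSM}(P)}W_s(P,X')$. $P,Q$ are sp-strongly equivalent iff for every LPMLN program $R$, $\mathrm{SSM}(P\cup R)=\mathrm{SSM}(Q\cup R)$ and $Pr_s(P\cup R,X)=Pr_s(Q\cup R,X)$ for all $X\in\mathrm{SSM}(P\cup R)$. An SE-interpretation is a pair $(X,Y)$ of interpretations with $X\subseteq Y$; it is an SE-model of $P$ iff $X\models(\overline{P_Y})^Y$; it is a soft SE-model of $P$ iff it is an SE-model and $Y\models P^h$; $\mathrm{SSE}(P)$ is the set of soft SE-models, and $W_s(P,(X,Y))=\exp(\sum_{w:r\in P^s,\ Y\models r}w)$.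
   Formalization: Programs are finite multisets of weighted rules and the union P ∪ R is multiset sum, so a soft rule shared by P and R counts twice; with finite sets and merging union the "if" direction is false. *)

theory Defs
  imports Complex_Main "HOL-Library.FSet" "HOL-Library.Multiset"
begin

datatype 'a literal = Pos 'a | Neg 'a

text \<open>Head, positive body and negative body. Any of the three may be empty, so facts and
  constraints are included.\<close>

datatype 'a rule = Rule
  (head: "'a literal fset")
  (pos_body: "'a literal fset")
  (neg_body: "'a literal fset")

definition is_interpretation :: "'a literal set \<Rightarrow> bool" where
  "is_interpretation I \<longleftrightarrow> (\<forall>a. \<not> (Pos a \<in> I \<and> Neg a \<in> I))"

definition sat_rule :: "'a literal set \<Rightarrow> 'a rule \<Rightarrow> bool" where
  "sat_rule I r \<longleftrightarrow>
    (fset (pos_body r) \<subseteq> I \<and> fset (neg_body r) \<inter> I = {} \<longrightarrow> fset (head r) \<inter> I \<noteq> {})"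

definition sat :: "'a literal set \<Rightarrow> 'a rule set \<Rightarrow> bool" where
  "sat I \<Pi> \<longleftrightarrow> (\<forall>r\<in>\<Pi>. sat_rule I r)"

definition reduct :: "'a rule set \<Rightarrow> 'a literal set \<Rightarrow> 'a rule set" where
  "reduct \<Pi> I = {Rule (head r) (pos_body r) {||} | r. r \<in> \<Pi> \<and> fset (neg_body r) \<inter> I = {}}"

definition stable_model :: "'a rule set \<Rightarrow> 'a literal set \<Rightarrow> bool" where
  "stable_model \<Pi> I \<longleftrightarrow>
    is_interpretation I \<and> sat I (reduct \<Pi> I) \<and> (\<forall>J. J \<subset> I \<longrightarrow> \<not> sat J (reduct \<Pi> I))"

datatype weight = Soft (weight_val: real) | Hard

text \<open>A program is a finite collection of weighted rules in which every occurrence of a soft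
  rule contributes its weight, and the union of two programs keeps the occurrences of both; it
  is therefore a multiset with \<open>+\<close> as union. A program given as a set is a multiset without
  repetitions. With unions that merge a soft rule common to both programs, the weight of a union
  would not be determined by the weights of its parts, and the characterization of strong
  equivalence by soft SE-models would fail: with \<open>r = (b \<leftarrow> a, not b)\<close> and
  \<open>s = (\<leftarrow> a, not b)\<close>, the programs \<open>{1:r, 1:s}\<close> and \<open>{2:r}\<close> have the same soft SE-models and
  weights, but adding \<open>{1:r, 1:(a \<leftarrow>)}\<close> separates them.\<close>

type_synonym 'a lpmln = "(weight \<times> 'a rule) multiset"

definition rules :: "'a lpmln \<Rightarrow> 'a rule set" where
  "rules P = {r. \<exists>w. (w, r) \<in># P}"

definition soft_part :: "'a lpmln \<Rightarrow> 'a lpmln" where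
  "soft_part P = {#(w, r) \<in># P. w \<noteq> Hard#}"

definition hard_part :: "'a lpmln \<Rightarrow> 'a lpmln" where
  "hard_part P = {#(w, r) \<in># P. w = Hard#}"

definition satisfied_part :: "'a lpmln \<Rightarrow> 'a literal set \<Rightarrow> 'a lpmln" where
  "satisfied_part P I = {#(w, r) \<in># P. sat_rule I r#}"

definition SM :: "'a lpmln \<Rightarrow> 'a literal set set" where
  "SM P = {I. stable_model (rules (satisfied_part P I)) I}"

definition SSM :: "'a lpmln \<Rightarrow> 'a literal set set" where
  "SSM P = {X \<in> SM P. sat X (rules (hard_part P))}"

definition W_s :: "'a lpmln \<Rightarrow> 'a literal set \<Rightarrow> real" where
  "W_s P X = exp (\<Sum>(w, r) \<in># satisfied_part (soft_part P) X. weight_val w)"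

text \<open>The sum below is over a finite set for every atom type: a stable model contains only
  literals that occur in heads.\<close>

definition Pr_s :: "'a lpmln \<Rightarrow> 'a literal set \<Rightarrow> real" where
  "Pr_s P X = W_s P X / (\<Sum>X' \<in> SSM P. W_s P X')"

definition sp_strongly_equivalent :: "'a lpmln \<Rightarrow> 'a lpmln \<Rightarrow> bool" where
  "sp_strongly_equivalent P Q \<longleftrightarrow>
    (\<forall>R. SSM (P + R) = SSM (Q + R) \<and>
         (\<forall>X \<in> SSM (P + R). Pr_s (P + R) X = Pr_s (Q + R) X))"

definition SE_interpretation :: "'a literal set \<times> 'a literal set \<Rightarrow> bool" where
  "SE_interpretation = (\<lambda>(X, Y). is_interpretation X \<and> is_interpretation Y \<and> X \<subseteq> Y)"

definition SE_model :: "'a lpmln \<Rightarrow> 'a literal set \<times> 'a literal set \<Rightarrow> bool" where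
  "SE_model P = (\<lambda>(X, Y). SE_interpretation (X, Y) \<and>
    sat X (reduct (rules (satisfied_part P Y)) Y))"

definition SSE :: "'a lpmln \<Rightarrow> ('a literal set \<times> 'a literal set) set" where
  "SSE P = {(X, Y). SE_model P (X, Y) \<and> sat Y (rules (hard_part P))}"

definition W_s_SE :: "'a lpmln \<Rightarrow> 'a literal set \<times> 'a literal set \<Rightarrow> real" where
  "W_s_SE P = (\<lambda>(X, Y). exp (\<Sum>(w, r) \<in># satisfied_part (soft_part P) Y. weight_val w))"

end

(* The soft stable models of a program are read off its soft SE-models: Y is one iff (Y, Y) is a
   soft SE-model and (X, Y) is not for any proper subset X of Y. Soft SE-models of a union are the
   common ones and weights multiply, which gives sufficiency. For necessity, soft SE-models and
   weights depend only on the finite set of literals occurring in P and Q, so finite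
   interpretations suffice. A pair (X, Y) in which the programs differ is exposed by adding the
   facts X and, for X a proper subset of Y, the rules y <- z with y, z in Y - X: then only X and Y
   itself can satisfy the reduct with respect to Y. Adding soft facts of weight 0 for all the
   relevant literals makes every candidate Y a soft stable model at once, and c is the ratio of the
   two normalization constants. *)

theory Submission
  imports Defs
begin

section \<open>Soft SE-models, stable models and unions of programs\<close>

lemma sat_reduct_iff:
  "sat J (reduct \<Pi> I) \<longleftrightarrow>
    (\<forall>r\<in>\<Pi>. fset (neg_body r) \<inter> I = {} \<longrightarrow> fset (pos_body r) \<subseteq> J \<longrightarrow> fset (head r) \<inter> J \<noteq> {})"
  unfolding sat_def reduct_def sat_rule_def by fastforce

lemma rules_plus [simp]: "rules (P + R) = rules P \<union> rules R"
  unfolding rules_def by auto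

lemma satisfied_part_plus [simp]:
  "satisfied_part (P + R) I = satisfied_part P I + satisfied_part R I"
  unfolding satisfied_part_def by simp

lemma soft_part_plus [simp]: "soft_part (P + R) = soft_part P + soft_part R"
  unfolding soft_part_def by simp

lemma hard_part_plus [simp]: "hard_part (P + R) = hard_part P + hard_part R"
  unfolding hard_part_def by simp

lemma rules_satisfied_part: "rules (satisfied_part P I) = {r \<in> rules P. sat_rule I r}"
  unfolding rules_def satisfied_part_def by auto

lemma rules_hard_part_subset: "rules (hard_part P) \<subseteq> rules P"
  unfolding rules_def hard_part_def by auto

lemma SSE_iff:
  "(X, Y) \<in> SSE P \<longleftrightarrow>
    is_interpretation X \<and> is_interpretation Y \<and> X \<subseteq> Y \<and> sat Y (rules (hard_part P)) \<and>
    (\<forall>r\<in>rules P. sat_rule Y r \<longrightarrow> fset (neg_body r) \<inter> Y = {} \<longrightarrow>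
      fset (pos_body r) \<subseteq> X \<longrightarrow> fset (head r) \<inter> X \<noteq> {})"
  unfolding SSE_def SE_model_def SE_interpretation_def
  by (auto simp: sat_reduct_iff rules_satisfied_part)

text \<open>A rule that survives in the satisfied part already holds in \<open>Y\<close>, so on the
  diagonal the reduct imposes nothing and only the hard rules matter.\<close>

lemma SSE_refl_iff:
  "(Y, Y) \<in> SSE P \<longleftrightarrow> is_interpretation Y \<and> sat Y (rules (hard_part P))"
  unfolding SSE_iff sat_rule_def by auto

lemma SSE_imp_refl: "(X, Y) \<in> SSE P \<Longrightarrow> (Y, Y) \<in> SSE P"
  unfolding SSE_refl_iff by (simp add: SSE_iff)

text \<open>Which rules enter the reduct depends on \<open>Y\<close> alone, so every condition is
  tested rule by rule and splits over the union.\<close>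

lemma SSE_plus: "SSE (P + R) = SSE P \<inter> SSE R"
  by (auto simp: SSE_iff sat_def)

lemma is_interpretation_subset: "is_interpretation Y \<Longrightarrow> X \<subseteq> Y \<Longrightarrow> is_interpretation X"
  unfolding is_interpretation_def by blast

lemma SSM_iff: "Y \<in> SSM P \<longleftrightarrow> (Y, Y) \<in> SSE P \<and> (\<forall>X. X \<subset> Y \<longrightarrow> (X, Y) \<notin> SSE P)"
proof -
  have "is_interpretation Y \<Longrightarrow> X \<subset> Y \<Longrightarrow> sat Y (rules (hard_part P)) \<Longrightarrow>
      (X, Y) \<in> SSE P \<longleftrightarrow> sat X (reduct (rules (satisfied_part P Y)) Y)" for X
    by (auto simp: SSE_iff sat_reduct_iff rules_satisfied_part intro: is_interpretation_subset)
  moreover have "sat Y (reduct (rules (satisfied_part P Y)) Y)"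
    by (auto simp: sat_reduct_iff rules_satisfied_part sat_rule_def)
  ultimately show ?thesis
    unfolding SSM_def SM_def stable_model_def SSE_refl_iff by auto
qed

lemma W_s_SE_eq: "W_s_SE P (X, Y) = W_s P Y"
  unfolding W_s_SE_def W_s_def by simp

lemma W_s_pos: "W_s P X > 0"
  unfolding W_s_def by simp

lemma W_s_plus: "W_s (P + R) X = W_s P X * W_s R X"
  unfolding W_s_def by (simp add: exp_add)

section \<open>Restriction to the literals that occur\<close>

definition lits :: "'a lpmln \<Rightarrow> 'a literal set" where
  "lits P = (\<Union>r\<in>rules P. fset (head r) \<union> fset (pos_body r) \<union> fset (neg_body r))"

lemma finite_lits: "finite (lits P)"
proof -
  have "rules P = snd ` set_mset P"
    unfolding rules_def by force
  then show ?thesis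
    unfolding lits_def by simp
qed

lemma rule_Int_lits:
  assumes "r \<in> rules P" and "lits P \<subseteq> L"
  shows "fset (head r) \<inter> (X \<inter> L) = fset (head r) \<inter> X"
    and "fset (neg_body r) \<inter> (X \<inter> L) = fset (neg_body r) \<inter> X"
    and "fset (pos_body r) \<subseteq> X \<inter> L \<longleftrightarrow> fset (pos_body r) \<subseteq> X"
  using assms unfolding lits_def by blast+

lemma sat_rule_Int_lits:
  "r \<in> rules P \<Longrightarrow> lits P \<subseteq> L \<Longrightarrow> sat_rule (X \<inter> L) r \<longleftrightarrow> sat_rule X r"
  unfolding sat_rule_def by (simp only: rule_Int_lits)

text \<open>No rule sees literals outside \<open>L\<close>. Consistency of \<open>Y\<close> and
  \<open>X \<subseteq> Y\<close> are assumed because intersecting with \<open>L\<close> may lose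
  them.\<close>

lemma SSE_Int_lits:
  assumes "lits P \<subseteq> L" and "is_interpretation Y" and "X \<subseteq> Y"
  shows "(X \<inter> L, Y \<inter> L) \<in> SSE P \<longleftrightarrow> (X, Y) \<in> SSE P"
proof -
  have "sat (Y \<inter> L) (rules (hard_part P)) \<longleftrightarrow> sat Y (rules (hard_part P))"
    unfolding sat_def using rules_hard_part_subset sat_rule_Int_lits[OF _ assms(1)] by blast
  moreover have "is_interpretation (X \<inter> L)" "is_interpretation X" "is_interpretation (Y \<inter> L)"
    using assms(2,3) by (auto intro: is_interpretation_subset)
  moreover have "X \<inter> L \<subseteq> Y \<inter> L"
    using assms(3) by blast
  ultimately show ?thesis
    using assms
    \<comment> \<open>The deleted rules would split
      \<open>fset (pos_body r) \<subseteq> X \<inter> L\<close> before \<open>rule_Int_lits\<close>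
      can match it.\<close>
    by (simp add: SSE_iff rule_Int_lits sat_rule_Int_lits del: Int_subset_iff inf.bounded_iff
        cong: ball_cong)
qed

lemma W_s_Int_lits:
  assumes "lits P \<subseteq> L"
  shows "W_s P (X \<inter> L) = W_s P X"
proof -
  have "sat_rule (X \<inter> L) r \<longleftrightarrow> sat_rule X r" if "(w, r) \<in># P" for w r
    using that by (intro sat_rule_Int_lits[OF _ assms]) (auto simp: rules_def)
  then have "satisfied_part (soft_part P) (X \<inter> L) = satisfied_part (soft_part P) X"
    unfolding satisfied_part_def soft_part_def by (intro filter_mset_cong) auto
  then show ?thesis
    unfolding W_s_def by simp
qed

lemma finite_SSM: "finite (SSM P)"
proof -
  have "X \<subseteq> lits P" if "X \<in> SSM P" for X
  proof (rule ccontr)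
    assume "\<not> X \<subseteq> lits P"
    then have less: "X \<inter> lits P \<subset> X" by blast
    have "(X, X) \<in> SSE P"
      using that unfolding SSM_iff by blast
    \<comment> \<open>Both pairs have the same intersection with \<open>lits P\<close>.\<close>
    moreover have "(X \<inter> lits P, X) \<in> SSE P \<longleftrightarrow> (X, X) \<in> SSE P"
      using SSE_Int_lits[of P "lits P" X X] SSE_Int_lits[of P "lits P" X "X \<inter> lits P"]
        calculation by (simp add: SSE_iff)
    ultimately show False
      using that less unfolding SSM_iff by blast
  qed
  then have "SSM P \<subseteq> Pow (lits P)" by blast
  then show ?thesis
    using finite_lits by (meson finite_Pow_iff finite_subset)
qed

section \<open>Test programs made of facts and links\<close>

definition uniform_program :: "weight \<Rightarrow> 'a rule set \<Rightarrow> 'a lpmln" where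
  "uniform_program w \<Pi> = image_mset (Pair w) (mset_set \<Pi>)"

lemma rules_uniform_program: "finite \<Pi> \<Longrightarrow> rules (uniform_program w \<Pi>) = \<Pi>"
  unfolding rules_def uniform_program_def by auto

lemma rules_hard_part_uniform_program:
  "finite \<Pi> \<Longrightarrow> rules (hard_part (uniform_program w \<Pi>)) = (if w = Hard then \<Pi> else {})"
  unfolding rules_def uniform_program_def hard_part_def by auto

definition facts :: "'a literal set \<Rightarrow> 'a rule set" where
  "facts A = (\<lambda>l. Rule {|l|} {||} {||}) ` A"

definition links :: "'a literal set \<Rightarrow> 'a rule set" where
  "links A = (\<lambda>(y, z). Rule {|y|} {|z|} {||}) ` (A \<times> A)"

lemma SSE_hard_facts:
  assumes "finite A"
  shows "(X, Y) \<in> SSE (uniform_program Hard (facts A)) \<longleftrightarrow>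
    is_interpretation Y \<and> X \<subseteq> Y \<and> A \<subseteq> X"
proof -
  have fin: "finite (facts A)"
    using assms unfolding facts_def by simp
  show ?thesis
    unfolding SSE_iff rules_uniform_program[OF fin] rules_hard_part_uniform_program[OF fin]
    by (auto simp: facts_def sat_def sat_rule_def intro: is_interpretation_subset)
qed

text \<open>A soft fact that fails in \<open>Y\<close> is dropped from the satisfied part, so only
  the facts in \<open>A \<inter> Y\<close> bind \<open>X\<close>.\<close>

lemma SSE_soft_facts:
  assumes "finite A"
  shows "(X, Y) \<in> SSE (uniform_program (Soft w) (facts A)) \<longleftrightarrow>
    is_interpretation Y \<and> X \<subseteq> Y \<and> A \<inter> Y \<subseteq> X"
proof -
  have fin: "finite (facts A)"
    using assms unfolding facts_def by simp
  show ?thesis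
    unfolding SSE_iff rules_uniform_program[OF fin] rules_hard_part_uniform_program[OF fin]
    by (auto simp: facts_def sat_def sat_rule_def intro: is_interpretation_subset)
qed

text \<open>As \<open>A \<subseteq> Y\<close>, all links hold in \<open>Y\<close>; in
  \<open>X\<close>, one element of \<open>A\<close> forces all the others.\<close>

lemma SSE_hard_links:
  assumes "finite A" and "A \<subseteq> Y"
  shows "(X, Y) \<in> SSE (uniform_program Hard (links A)) \<longleftrightarrow>
    is_interpretation Y \<and> X \<subseteq> Y \<and> (A \<inter> X = {} \<or> A \<subseteq> X)"
proof -
  have fin: "finite (links A)"
    using assms unfolding links_def by simp
  show ?thesis
    unfolding SSE_iff rules_uniform_program[OF fin] rules_hard_part_uniform_program[OF fin]
    using assms(2)
    by (auto simp: links_def sat_def sat_rule_def intro: is_interpretation_subset)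
qed

lemma W_s_uniform_program_0: "W_s (uniform_program (Soft 0) \<Pi>) X = 1"
proof -
  have "(\<Sum>(w, r) \<in># satisfied_part (soft_part (uniform_program (Soft 0) \<Pi>)) X. weight_val w) =
      (\<Sum>_ \<in># satisfied_part (soft_part (uniform_program (Soft 0) \<Pi>)) X. 0)"
    by (intro arg_cong[where f = sum_mset] image_mset_cong)
      (auto simp: satisfied_part_def soft_part_def uniform_program_def)
  then show ?thesis
    unfolding W_s_def by simp
qed

section \<open>Equal soft stable models force equal soft SE-models\<close>

lemma SSE_subset_if_SSM_eq:
  assumes SSM: "\<And>R. SSM (P + R) = SSM (Q + R)"
    and fin: "finite Y" and XY: "(X, Y) \<in> SSE P"
  shows "(X, Y) \<in> SSE Q"
proof -
  have Y: "is_interpretation Y" "X \<subseteq> Y"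
    using XY by (auto simp: SSE_iff)
  \<comment> \<open>The facts rule out every proper subset of \<open>Y\<close>, so stability tests
    only \<open>(Y, Y)\<close>, and this transfers to \<open>Q\<close>.\<close>
  have "Y \<in> SSM (P + uniform_program Hard (facts Y))"
    using SSE_imp_refl[OF XY] Y by (auto simp: SSM_iff SSE_plus SSE_hard_facts[OF fin])
  then have YY: "(Y, Y) \<in> SSE Q"
    unfolding SSM by (simp add: SSM_iff SSE_plus)
  show ?thesis
  proof (rule ccontr)
    assume nXY: "(X, Y) \<notin> SSE Q"
    define R where "R = uniform_program Hard (facts X) + uniform_program Hard (links (Y - X))"
    have finX: "finite X" and finD: "finite (Y - X)"
      using fin Y(2) finite_subset by auto
    have R: "(J, Y) \<in> SSE R \<longleftrightarrow> J = X \<or> J = Y" for J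
      using Y by (auto simp: R_def SSE_plus SSE_hard_facts[OF finX] SSE_hard_links[OF finD])
    have "Y \<in> SSM (Q + R)"
      using YY nXY by (auto simp: SSM_iff SSE_plus R)
    \<comment> \<open>\<open>X\<close> differs from \<open>Y\<close>, since \<open>(Y, Y)\<close> is
      in \<open>SSE Q\<close> and \<open>(X, Y)\<close> is not; hence \<open>X\<close> refutes
      minimality of \<open>Y\<close>.\<close>
    moreover have "Y \<notin> SSM (P + R)"
      using XY nXY YY Y(2) by (auto simp: SSM_iff SSE_plus R)
    ultimately show False
      using SSM by blast
  qed
qed

lemma SSE_eq_if_SSM_eq:
  assumes SSM: "\<And>R. SSM (P + R) = SSM (Q + R)"
  shows "SSE P = SSE Q"
proof -
  define L where "L = lits P \<union> lits Q"
  have L: "lits P \<subseteq> L" "lits Q \<subseteq> L" "finite L"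
    unfolding L_def using finite_lits by auto
  have "(X, Y) \<in> SSE P \<longleftrightarrow> (X, Y) \<in> SSE Q" for X Y
  proof (cases "is_interpretation Y \<and> X \<subseteq> Y")
    case True
    have "(X \<inter> L, Y \<inter> L) \<in> SSE P \<longleftrightarrow> (X \<inter> L, Y \<inter> L) \<in> SSE Q"
      using SSE_subset_if_SSM_eq[of P Q] SSE_subset_if_SSM_eq[of Q P] SSM L(3) by blast
    then show ?thesis
      using SSE_Int_lits L(1,2) True by blast
  qed (auto simp: SSE_iff)
  then show ?thesis by auto
qed

section \<open>Proportional weights and equal probabilities\<close>

lemma sp_strongly_equivalent_if:
  assumes SSE: "SSE P = SSE Q"
    and c: "\<And>X Y. (X, Y) \<in> SSE P \<Longrightarrow> W_s P Y = c * W_s Q Y"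
  shows "sp_strongly_equivalent P Q"
  unfolding sp_strongly_equivalent_def
proof (intro allI conjI ballI)
  fix R
  show SSM: "SSM (P + R) = SSM (Q + R)"
    by (auto simp: SSM_iff SSE_plus SSE)
  have W: "W_s (P + R) X = c * W_s (Q + R) X" if "X \<in> SSM (P + R)" for X
    using that c[of X X] by (simp add: SSM_iff SSE_plus W_s_plus)
  fix X assume X: "X \<in> SSM (P + R)"
  \<comment> \<open>The sign of \<open>c\<close> is not assumed; the positive weight of the stable
    model at hand excludes zero, so \<open>c\<close> cancels in the quotient.\<close>
  have "c \<noteq> 0"
    using W[OF X] W_s_pos[of "P + R" X] by auto
  moreover have "(\<Sum>X' \<in> SSM (P + R). W_s (P + R) X') = c * (\<Sum>X' \<in> SSM (Q + R). W_s (Q + R) X')"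
    using W by (simp add: sum_distrib_left SSM)
  ultimately show "Pr_s (P + R) X = Pr_s (Q + R) X"
    unfolding Pr_s_def using W[OF X] by simp
qed

lemma sp_strongly_equivalent_imp_proportional:
  assumes "sp_strongly_equivalent P Q"
  shows "\<exists>c. \<forall>(X, Y) \<in> SSE P. W_s P Y = c * W_s Q Y"
proof -
  define L where "L = lits P \<union> lits Q"
  have L: "lits P \<subseteq> L" "lits Q \<subseteq> L" "finite L"
    unfolding L_def using finite_lits by auto
  define R where "R = uniform_program (Soft 0) (facts L)"
  define S where "S P' = (\<Sum>X \<in> SSM (P' + R). W_s (P' + R) X)" for P'
  have "W_s P Y = S P / S Q * W_s Q Y" if "(X, Y) \<in> SSE P" for X Y
  proof -
    have Y: "is_interpretation Y"
      using that by (simp add: SSE_iff)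
    have "(Y \<inter> L, Y \<inter> L) \<in> SSE P"
      using SSE_Int_lits[OF L(1) Y subset_refl] SSE_imp_refl[OF that] by blast
    \<comment> \<open>The facts of \<open>R\<close> that hold in \<open>Y \<inter> L\<close> are
      exactly its elements, so no proper subset competes.\<close>
    then have YP: "Y \<inter> L \<in> SSM (P + R)"
      using is_interpretation_subset[OF Y]
      by (auto simp: SSM_iff SSE_plus R_def SSE_soft_facts[OF L(3)])
    then have YQ: "Y \<inter> L \<in> SSM (Q + R)" and Pr: "Pr_s (P + R) (Y \<inter> L) = Pr_s (Q + R) (Y \<inter> L)"
      using assms unfolding sp_strongly_equivalent_def by auto
    \<comment> \<open>Positivity needs a nonempty finite index set: \<open>YP\<close> and
      \<open>YQ\<close> give members, and a sum over an infinite set would be 0 by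
      convention.\<close>
    have "S P > 0" "S Q > 0"
      unfolding S_def using YP YQ by (auto intro!: sum_pos finite_SSM W_s_pos)
    \<comment> \<open>\<open>R\<close> has weight 1, so the probabilities compare the weights of
      \<open>P\<close> and \<open>Q\<close> themselves.\<close>
    moreover have "W_s P Y / S P = W_s Q Y / S Q"
      using Pr unfolding Pr_s_def S_def[symmetric]
      by (simp add: W_s_plus R_def W_s_uniform_program_0 W_s_Int_lits L)
    ultimately show ?thesis
      by (simp add: field_simps)
  qed
  then show ?thesis by blast
qed

theorem theorem4p5:
  fixes P Q :: "'a lpmln"
  shows "sp_strongly_equivalent P Q \<longleftrightarrow>
    SSE P = SSE Q \<and>
    (\<exists>c::real. \<forall>(X, Y) \<in> SSE P. W_s_SE P (X, Y) = c * W_s_SE Q (X, Y))"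
proof
  assume "sp_strongly_equivalent P Q"
  then show "SSE P = SSE Q \<and>
      (\<exists>c::real. \<forall>(X, Y) \<in> SSE P. W_s_SE P (X, Y) = c * W_s_SE Q (X, Y))"
    using SSE_eq_if_SSM_eq[of P Q] sp_strongly_equivalent_imp_proportional[of P Q]
    by (simp add: W_s_SE_eq sp_strongly_equivalent_def)
next
  assume "SSE P = SSE Q \<and>
      (\<exists>c::real. \<forall>(X, Y) \<in> SSE P. W_s_SE P (X, Y) = c * W_s_SE Q (X, Y))"
  then show "sp_strongly_equivalent P Q"
    by (auto simp: W_s_SE_eq intro: sp_strongly_equivalent_if)
qed

end
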